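(* Let $K$ be a field. The following are equivalent: (1) $K\cong \mathbb{F}_{2}$; (2) for every positive integer $n$, the matrix ring $\mathcal{M}_{n}(K)$ is nil-clean; (3) there exists a positive integer $n$ such that the matrix ring $\mathcal{M}_{n}(K)$ is nil-clean.
   Context: An element of an (associative, unital) ring $R$ is called nil-clean if it is the sum of an idempotent and a nilpotent element of $R$. The ring $R$ is called nil-clean if all its elements are nil-clean. $\mathcal{M}_n(K)$ denotes the ring of $n\times n$ matrices over $K$, and $\mathbb{F}_2$ is the field with two elements. *)

theory Defs
  imports "HOL-Library.Z2" "HOL-Algebra.QuotRing" "Jordan_Normal_Form.VS_Connect"
begin

definition idempotent_element :: "('a, 'm) ring_scheme \<Rightarrow> 'a \<Rightarrow> bool" where
  "idempotent_element R e \<longleftrightarrow> e \<in> carrier R \<and> e \<otimes>\<^bsub>R\<^esub> e = e"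

definition nilpotent_element :: "('a, 'm) ring_scheme \<Rightarrow> 'a \<Rightarrow> bool" where
  "nilpotent_element R b \<longleftrightarrow> b \<in> carrier R \<and> (\<exists>k::nat. k > 0 \<and> b [^]\<^bsub>R\<^esub> k = \<zero>\<^bsub>R\<^esub>)"

definition nil_clean_element :: "('a, 'm) ring_scheme \<Rightarrow> 'a \<Rightarrow> bool" where
  "nil_clean_element R x \<longleftrightarrow>
     (\<exists>e b. idempotent_element R e \<and> nilpotent_element R b \<and> x = e \<oplus>\<^bsub>R\<^esub> b)"

definition nil_clean_ring :: "('a, 'm) ring_scheme \<Rightarrow> bool" where
  "nil_clean_ring R \<longleftrightarrow> ring R \<and> (\<forall>x \<in> carrier R. nil_clean_element R x)"

abbreviation matrix_ring :: "'a::field itself \<Rightarrow> nat \<Rightarrow> 'a mat ring" where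
  "matrix_ring K n \<equiv> ring_mat K n ()"

text \<open>The type \<open>bit\<close> is the field with two elements; \<open>class_ring\<close> turns a ring given by a type
  class into a ring record with carrier \<open>UNIV\<close>, so that \<open>\<simeq>\<close> (ring isomorphism) applies.\<close>

abbreviation F2 :: "bit ring" where
  "F2 \<equiv> class_ring"

end

theory Submission
  imports Defs
begin

text \<open>
  A field is isomorphic to \<open>F2\<close> exactly when each of its elements is \<open>0\<close> or \<open>1\<close>
  (\<open>class_ring_iso_F2_iff\<close>).

  If the \<open>n \<times> n\<close> matrices are nil-clean for a single \<open>n > 0\<close>, decompose a scalar matrix
  \<open>c 1 = E + B\<close>.  The last nonzero power \<open>X\<close> of \<open>B\<close> satisfies \<open>X B = 0\<close>, hence \<open>X E = c X\<close>, and
  \<open>E\<^sup>2 = E\<close> forces \<open>c\<^sup>2 = c\<close> (\<open>idempotent_scalar_if_nil_clean_mat\<close>).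

  Conversely, let the field have two elements.  Nil-cleanness is invariant under similarity
  (\<open>nil_clean_mat_similar\<close>) and passes from diagonal blocks to block triangular matrices
  (\<open>nil_clean_mat_block_triangular\<close>).  The Krylov space of a nonzero vector is invariant, and on it
  the matrix acts as a companion matrix, so by induction on the size only companion matrices remain
  (\<open>nil_clean_mat_if_krylov_columns\<close>).

  The trace of a nilpotent matrix is \<open>0\<close> and that of an idempotent is its rank in the field, so the
  trace of a companion matrix dictates the parity of the rank of the idempotent.  If the trace is
  \<open>1\<close>, the last column alone is an idempotent of rank one, and the rest is the nilpotent shift.  If
  the trace is \<open>0\<close>, the Krylov basis \<open>v, A v, A\<^sup>2 v, \<dots>\<close> is replaced by
  \<open>v, (A + 1) v, A (A + 1) v, \<dots>\<close>; this puts a \<open>1\<close> at both ends of the diagonal, and the first and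
  the last column give, after a small correction, an idempotent of rank two, except that
  some such matrices of size at most two are nilpotent themselves
  (\<open>nil_clean_mat_twisted_companion\<close>, \<open>nil_clean_mat_companion\<close>).
\<close>

section \<open>Nil-clean matrices\<close>

text \<open>Exponent \<open>0\<close> is harmless, since \<open>B\<^sup>0 = 0\<close> implies \<open>B = 0\<close>.  Size \<open>0\<close> is included because it is
  the base of the induction on the size.\<close>

definition nil_clean_mat :: "nat \<Rightarrow> 'a::field mat \<Rightarrow> bool" where
  "nil_clean_mat n M \<longleftrightarrow> (\<exists>E B k. E \<in> carrier_mat n n \<and> B \<in> carrier_mat n n
     \<and> E * E = E \<and> B ^\<^sub>m k = 0\<^sub>m n n \<and> M = E + B)"

lemma nil_clean_element_iff_nil_clean_mat:
  "nil_clean_element (matrix_ring TYPE('a::field) n) M \<longleftrightarrow> nil_clean_mat n M"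
proof
  assume "nil_clean_element (matrix_ring TYPE('a) n) M"
  then obtain E B k where "E \<in> carrier_mat n n" "E * E = E" "B \<in> carrier_mat n n"
    "B [^]\<^bsub>matrix_ring TYPE('a) n\<^esub> (k::nat) = 0\<^sub>m n n" "M = E + B"
    unfolding nil_clean_element_def idempotent_element_def nilpotent_element_def
    by (auto simp: ring_mat_simps)
  then show "nil_clean_mat n M"
    unfolding nil_clean_mat_def by (metis pow_mat_ring_pow)
next
  assume "nil_clean_mat n M"
  then obtain E B k where E: "E \<in> carrier_mat n n" "E * E = E" and B: "B \<in> carrier_mat n n"
    "B ^\<^sub>m k = 0\<^sub>m n n" and M: "M = E + B"
    unfolding nil_clean_mat_def by blast
  have "B ^\<^sub>m Suc k = 0\<^sub>m n n" using B by simp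
  then have "B [^]\<^bsub>matrix_ring TYPE('a) n\<^esub> Suc k = 0\<^sub>m n n"
    using pow_mat_ring_pow[OF B(1)] by metis
  then have "\<exists>k>0. B [^]\<^bsub>matrix_ring TYPE('a) n\<^esub> (k::nat) = 0\<^sub>m n n" by blast
  with E B M show "nil_clean_element (matrix_ring TYPE('a) n) M"
    unfolding nil_clean_element_def idempotent_element_def nilpotent_element_def
    by (auto simp: ring_mat_simps simp del: nat_pow_Suc)
qed

lemma index_mult_mat_sum:
  assumes "A \<in> carrier_mat n m" "B \<in> carrier_mat m p" "i < n" "j < p"
  shows "(A * B) $$ (i, j) = (\<Sum>l<m. A $$ (i, l) * B $$ (l, j))"
  using assms by (auto simp: scalar_prod_def atLeast0LessThan)

text \<open>A matrix that is strictly triangular after some reordering of the indices is nilpotent: along a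
  nonzero product of entries the rank \<open>r\<close> grows by at least one at each factor.\<close>

lemma nilpotent_mat_if_rank:
  fixes B :: "'a::field mat" and r :: "nat \<Rightarrow> nat"
  assumes B: "B \<in> carrier_mat n n"
    and r: "\<And>i j. i < n \<Longrightarrow> j < n \<Longrightarrow> B $$ (i, j) \<noteq> 0 \<Longrightarrow> r j < r i"
  shows "\<exists>k. B ^\<^sub>m k = 0\<^sub>m n n"
proof -
  have up: "r j + k \<le> r i" if "i < n" "j < n" "(B ^\<^sub>m k) $$ (i, j) \<noteq> 0" for i j k
    using that
  proof (induction k arbitrary: j)
    case 0
    then show ?case using B by (cases "i = j") auto
  next
    case (Suc k)
    have "(\<Sum>l<n. (B ^\<^sub>m k) $$ (i, l) * B $$ (l, j)) \<noteq> 0"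
      using Suc.prems index_mult_mat_sum[OF pow_carrier_mat[OF B] B] by simp
    then obtain l where "l < n" "(B ^\<^sub>m k) $$ (i, l) * B $$ (l, j) \<noteq> 0"
      by (meson lessThan_iff sum.neutral)
    then have "r l + k \<le> r i" "r j < r l"
      using Suc.IH[of l] Suc.prems r[of l j] by auto
    then show ?case by simp
  qed
  define N where "N = Suc (\<Sum>i<n. r i)"
  have "(B ^\<^sub>m N) $$ (i, j) = 0" if "i < n" "j < n" for i j
  proof (rule ccontr)
    assume "(B ^\<^sub>m N) $$ (i, j) \<noteq> 0"
    then have "N \<le> r i" using up[OF that] by fastforce
    moreover have "r i \<le> (\<Sum>i<n. r i)" using that by (intro member_le_sum) auto
    ultimately show False by (simp add: N_def)
  qed
  then have "B ^\<^sub>m N = 0\<^sub>m n n" using B by (intro eq_matI) auto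
  then show ?thesis by blast
qed

text \<open>A matrix whose columns outside an index set \<open>S\<close> vanish and whose \<open>S \<times> S\<close> block is the identity
  is idempotent: its columns in \<open>S\<close> span its range, and it fixes each of them.  All the idempotents
  for companion matrices below are of this shape.\<close>

lemma nil_clean_matI_identity_block:
  fixes M :: "'a::field mat" and e :: "nat \<Rightarrow> nat \<Rightarrow> 'a" and r :: "nat \<Rightarrow> nat"
  assumes M: "M \<in> carrier_mat n n"
    and out: "\<And>i j. i < n \<Longrightarrow> j < n \<Longrightarrow> j \<notin> S \<Longrightarrow> e i j = 0"
    and ins: "\<And>i j. i < n \<Longrightarrow> j < n \<Longrightarrow> i \<in> S \<Longrightarrow> j \<in> S \<Longrightarrow> e i j = (if i = j then 1 else 0)"
    and r: "\<And>i j. i < n \<Longrightarrow> j < n \<Longrightarrow> M $$ (i, j) \<noteq> e i j \<Longrightarrow> r j < r i"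
  shows "nil_clean_mat n M"
proof -
  define E where "E = mat n n (\<lambda>(i, j). e i j)"
  have E: "E \<in> carrier_mat n n" by (simp add: E_def)
  have idem: "E * E = E"
  proof (rule eq_matI)
    fix i j assume "i < dim_row E" "j < dim_col E"
    then have ij: "i < n" "j < n" using E by auto
    have "(E * E) $$ (i, j) = (\<Sum>l<n. e i l * e l j)"
      using ij by (simp add: index_mult_mat_sum[OF E E]) (simp add: E_def)
    also have "\<dots> = (\<Sum>l<n. if l = j then e i j else 0)"
    proof (rule sum.cong[OF refl])
      fix l assume "l \<in> {..<n}"
      then show "e i l * e l j = (if l = j then e i j else 0)"
        using ij out[of i l] out[of l j] out[of i j] ins[of l j] by (cases "l \<in> S"; cases "j \<in> S") auto
    qed
    also have "\<dots> = E $$ (i, j)" using ij by (simp add: E_def)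
    finally show "(E * E) $$ (i, j) = E $$ (i, j)" .
  qed (use E in auto)
  have "\<exists>k. (M - E) ^\<^sub>m k = 0\<^sub>m n n"
    by (rule nilpotent_mat_if_rank[where r = r]) (use M r in \<open>auto simp: E_def\<close>)
  then obtain k where k: "(M - E) ^\<^sub>m k = 0\<^sub>m n n" by blast
  have "M = E + (M - E)" using M E by (intro eq_matI) auto
  with E M idem k show ?thesis
    unfolding nil_clean_mat_def by (intro exI[of _ E] exI[of _ "M - E"] exI[of _ k]) auto
qed

text \<open>Similarity is phrased as an intertwining relation because its two sides can be compared
  without computing the inverse of \<open>P\<close>.\<close>

lemma nil_clean_mat_similar:
  fixes M :: "'a::field mat"
  assumes car: "M \<in> carrier_mat n n" "H \<in> carrier_mat n n" "P \<in> carrier_mat n n" "Q \<in> carrier_mat n n"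
    and PQ: "P * Q = 1\<^sub>m n" and inter: "P * H = M * P" and H: "nil_clean_mat n H"
  shows "nil_clean_mat n M"
proof -
  note [simp] = mult_carrier_mat[where ?n = n and ?nr = n and ?nc = n]
  have QP: "Q * P = 1\<^sub>m n" using mat_mult_left_right_inverse[OF car(3,4) PQ] .
  obtain E B k where E: "E \<in> carrier_mat n n" "E * E = E" and B: "B \<in> carrier_mat n n"
    "B ^\<^sub>m k = 0\<^sub>m n n" and HEB: "H = E + B"
    using H unfolding nil_clean_mat_def by blast
  have M: "M = P * H * Q"
    using car PQ by (simp add: inter assoc_mult_mat[of _ n n _ n _ n])
  have idem: "(P * E * Q) * (P * E * Q) = P * E * Q"
  proof -
    have "(P * E * Q) * (P * E * Q) = P * E * (Q * P) * (E * Q)"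
      using car E(1) by (simp add: assoc_mult_mat[of _ n n _ n _ n])
    also have "\<dots> = P * (E * E) * Q"
      using car E(1) unfolding QP by (simp add: assoc_mult_mat[of _ n n _ n _ n])
    finally show ?thesis by (simp add: E(2))
  qed
  have "similar_mat_wit (P * B * Q) B P Q"
    using car B(1) PQ QP by (auto simp: similar_mat_wit_def Let_def)
  then have "(P * B * Q) ^\<^sub>m k = P * B ^\<^sub>m k * Q" by (rule similar_mat_wit_pow_id)
  then have nil: "(P * B * Q) ^\<^sub>m k = 0\<^sub>m n n" using car by (simp add: B(2))
  have "M = P * E * Q + P * B * Q"
    unfolding M HEB using car E(1) B(1)
    by (simp add: mult_add_distrib_mat[of _ n n _ n] add_mult_distrib_mat[of _ n n _ _ n])
  with car E(1) B(1) idem nil show ?thesis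
    unfolding nil_clean_mat_def
    by (intro exI[of _ "P * E * Q"] exI[of _ "P * B * Q"] exI[of _ k]) simp
qed

text \<open>The block diagonal matrix of the two idempotents is idempotent, so the corner \<open>X\<close> can be put
  entirely into the nilpotent part.  If the diagonal blocks of the latter have nilpotency exponents
  \<open>k\<close> and \<open>m\<close>, the exponent \<open>k + m\<close> suffices: the power \<open>k\<close> kills the first block column, and
  multiplying by \<open>m\<close> further factors multiplies the second one by the power \<open>m\<close> of the lower block.\<close>

lemma nil_clean_mat_block_triangular:
  fixes A :: "'a::field mat"
  assumes A: "nil_clean_mat p A" and D: "nil_clean_mat q D" and X: "X \<in> carrier_mat p q"
  shows "nil_clean_mat (p + q) (four_block_mat A X (0\<^sub>m q p) D)"
proof -
  obtain E1 B1 k where E1: "E1 \<in> carrier_mat p p" "E1 * E1 = E1" and B1: "B1 \<in> carrier_mat p p"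
    "B1 ^\<^sub>m k = 0\<^sub>m p p" and A: "A = E1 + B1"
    using A unfolding nil_clean_mat_def by blast
  obtain E2 B2 m where E2: "E2 \<in> carrier_mat q q" "E2 * E2 = E2" and B2: "B2 \<in> carrier_mat q q"
    "B2 ^\<^sub>m m = 0\<^sub>m q q" and D: "D = E2 + B2"
    using D unfolding nil_clean_mat_def by blast
  define E where "E = four_block_mat E1 (0\<^sub>m p q) (0\<^sub>m q p) E2"
  define B where "B = four_block_mat B1 X (0\<^sub>m q p) B2"
  have car: "E \<in> carrier_mat (p + q) (p + q)" "B \<in> carrier_mat (p + q) (p + q)"
    using E1 E2 B1 B2 by (auto simp: E_def B_def)
  have idem: "E * E = E"
    using E1 E2 by (simp add: E_def mult_four_block_mat[of _ p p _ q _ q _ _ p _ q])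
  have step: "four_block_mat F Y (0\<^sub>m q p) G * B
      = four_block_mat (F * B1) (F * X + Y * B2) (0\<^sub>m q p) (G * B2)"
    if "F \<in> carrier_mat p p" "Y \<in> carrier_mat p q" "G \<in> carrier_mat q q" for F Y G
    using that B1 B2 X by (simp add: B_def mult_four_block_mat[of _ p p _ q _ q _ _ p _ q])
  have "\<exists>Y \<in> carrier_mat p q. B ^\<^sub>m j = four_block_mat (B1 ^\<^sub>m j) Y (0\<^sub>m q p) (B2 ^\<^sub>m j)" for j
  proof (induction j)
    case 0
    show ?case using B1 B2 car by (intro bexI[of _ "0\<^sub>m p q"]) auto
  next
    case (Suc j)
    then obtain Y where Y: "Y \<in> carrier_mat p q"
      "B ^\<^sub>m j = four_block_mat (B1 ^\<^sub>m j) Y (0\<^sub>m q p) (B2 ^\<^sub>m j)" by blast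
    show ?case
      using B1 B2 X Y(1) by (intro bexI[of _ "B1 ^\<^sub>m j * X + Y * B2"]) (auto simp: Y(2) step)
  qed
  then obtain Y where Y: "Y \<in> carrier_mat p q"
    "B ^\<^sub>m k = four_block_mat (0\<^sub>m p p) Y (0\<^sub>m q p) (B2 ^\<^sub>m k)"
    using B1(2) by metis
  have "B ^\<^sub>m (k + j) = four_block_mat (0\<^sub>m p p) (Y * B2 ^\<^sub>m j) (0\<^sub>m q p) (B2 ^\<^sub>m k * B2 ^\<^sub>m j)" for j
  proof (induction j)
    case 0
    show ?case using Y B2 by simp
  next
    case (Suc j)
    have Yc: "Y * B2 ^\<^sub>m j \<in> carrier_mat p q" "B2 ^\<^sub>m k * B2 ^\<^sub>m j \<in> carrier_mat q q"
      using Y(1) B2(1) by (auto intro!: mult_carrier_mat[of _ _ q])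
    have "B ^\<^sub>m (k + Suc j)
        = four_block_mat (0\<^sub>m p p) (Y * B2 ^\<^sub>m j * B2) (0\<^sub>m q p) (B2 ^\<^sub>m k * B2 ^\<^sub>m j * B2)"
      using B1(1) X B2(1) Yc mult_carrier_mat[OF Yc(1) B2(1)] by (simp add: Suc.IH step)
    also have "Y * B2 ^\<^sub>m j * B2 = Y * B2 ^\<^sub>m Suc j"
      using assoc_mult_mat[OF Y(1) pow_carrier_mat[OF B2(1)] B2(1)] by simp
    also have "B2 ^\<^sub>m k * B2 ^\<^sub>m j * B2 = B2 ^\<^sub>m k * B2 ^\<^sub>m Suc j"
      using assoc_mult_mat[OF pow_carrier_mat[OF B2(1)] pow_carrier_mat[OF B2(1)] B2(1)] by simp
    finally show ?case .
  qed
  from this[of m] have nil: "B ^\<^sub>m (k + m) = 0\<^sub>m (p + q) (p + q)"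
    using Y(1) B2 right_mult_zero_mat[OF Y(1)] right_mult_zero_mat[OF pow_carrier_mat[OF B2(1)]] by simp
  have "four_block_mat A X (0\<^sub>m q p) D = E + B"
    using E1 E2 B1 B2 X by (simp add: A D E_def B_def add_four_block_mat[of _ p p _ q _ q])
  with car idem nil show ?thesis unfolding nil_clean_mat_def by blast
qed

section \<open>Companion matrices over the field with two elements\<close>

lemma char_two_if_two_elements:
  assumes "\<And>x::'a::field. x = 0 \<or> x = 1"
  shows "(x::'a) + x = 0"
proof -
  have "(1::'a) + 1 = 0"
    using assms[of "1 + 1"] by (metis add_cancel_right_right one_neq_zero)
  then show ?thesis using assms[of x] by auto
qed

text \<open>The matrix \<open>H\<close> maps \<open>e\<^sub>0\<close> to \<open>e\<^sub>0 + e\<^sub>1\<close>, then \<open>e\<^sub>1\<close> to \<open>e\<^sub>2\<close> and so on, and \<open>e\<^bsub>n-1\<^esub>\<close> to a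
  vector \<open>w\<close> with last coordinate \<open>1\<close>.  If \<open>w\<close> has first coordinate \<open>0\<close>, take the idempotent that maps
  \<open>e\<^sub>0\<close> to \<open>e\<^sub>0\<close> and \<open>e\<^bsub>n-1\<^esub>\<close> to \<open>w\<close>; the shift remains.  If that coordinate is \<open>1\<close>, the identity
  block is restored by taking \<open>w - e\<^sub>0\<close> instead of \<open>w\<close>, and then \<open>e\<^sub>0 + e\<^sub>1\<close> instead of \<open>e\<^sub>0\<close>: what
  remains is the shift
  \<open>e\<^sub>1 \<mapsto> e\<^sub>2 \<mapsto> \<dots> \<mapsto> e\<^bsub>n-1\<^esub> \<mapsto> e\<^sub>0 \<mapsto> 0\<close>.  The last choice needs \<open>e\<^sub>1 \<noteq> e\<^bsub>n-1\<^esub>\<close>; for \<open>n = 2\<close> the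
  matrix \<open>H\<close> is itself nilpotent.\<close>

lemma nil_clean_mat_twisted_companion:
  fixes H :: "'a::field mat"
  assumes two: "\<And>x::'a. x = 0 \<or> x = 1"
    and H: "H \<in> carrier_mat n n" and n: "2 \<le> n"
    and col: "\<And>i j. i < n \<Longrightarrow> Suc j < n \<Longrightarrow>
       H $$ (i, j) = (if i = Suc j \<or> i = 0 \<and> j = 0 then 1 else 0)"
    and corner: "H $$ (n - 1, n - 1) = 1"
  shows "nil_clean_mat n H"
proof -
  consider "H $$ (0, n - 1) = 0" | "H $$ (0, n - 1) = 1" "n = 2" | "H $$ (0, n - 1) = 1" "3 \<le> n"
    using two[of "H $$ (0, n - 1)"] n by fastforce
  then show ?thesis
  proof cases
    case 1
    show ?thesis
    proof (rule nil_clean_matI_identity_block[OF H, where S = "{0, n - 1}" and r = "\<lambda>i. i" and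
          e = "\<lambda>i j. if j = n - 1 then H $$ (i, j) else if i = 0 \<and> j = 0 then 1 else 0"])
    qed (use n 1 corner col in \<open>auto split: if_splits\<close>)
  next
    case 2
    have "H $$ (i, j) = 1" if "i < 2" "j < 2" for i j
      using that col[of i j] 2 corner by (cases "j = 0"; cases "i = 0") (auto simp: less_2_cases_iff)
    then have "H ^\<^sub>m 2 = 0\<^sub>m n n"
      using H \<open>n = 2\<close> char_two_if_two_elements[OF two, of 1]
      by (intro eq_matI) (auto simp: numeral_2_eq_2 scalar_prod_def)
    then show ?thesis using H unfolding nil_clean_mat_def
      by (intro exI[of _ "0\<^sub>m n n"] exI[of _ H] exI[of _ 2]) auto
  next
    case 3
    show ?thesis
    proof (rule nil_clean_matI_identity_block[OF H, where S = "{0, n - 1}" and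
          r = "\<lambda>i. if i = 0 then n else i" and
          e = "\<lambda>i j. if j = n - 1 then H $$ (i, j) - (if i = 0 then 1 else 0)
                 else if i \<le> 1 \<and> j = 0 then 1 else 0"])
    qed (use 3 corner col in \<open>auto split: if_splits\<close>)
  qed
qed

text \<open>The corner entry of a companion matrix is its trace.  If it is \<open>0\<close>, the basis
  \<open>e\<^sub>0, e\<^sub>0 + e\<^sub>1, e\<^sub>1 + e\<^sub>2, \<dots>\<close> turns the companion matrix into the twisted form above.\<close>

lemma nil_clean_mat_companion:
  fixes C :: "'a::field mat"
  assumes two: "\<And>x::'a. x = 0 \<or> x = 1"
    and C: "C \<in> carrier_mat n n" and n: "0 < n"
    and col: "\<And>i j. i < n \<Longrightarrow> Suc j < n \<Longrightarrow> C $$ (i, j) = (if i = Suc j then 1 else 0)"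
  shows "nil_clean_mat n C"
proof -
  consider "C $$ (n - 1, n - 1) = 1" | "C $$ (n - 1, n - 1) = 0" "n = 1"
    | "C $$ (n - 1, n - 1) = 0" "2 \<le> n"
    using two[of "C $$ (n - 1, n - 1)"] n by fastforce
  then show ?thesis
  proof cases
    case 1
    show ?thesis
    proof (rule nil_clean_matI_identity_block[OF C, where S = "{n - 1}" and r = "\<lambda>i. i" and
          e = "\<lambda>i j. if j = n - 1 then C $$ (i, j) else 0"])
    qed (use 1 col in \<open>auto split: if_splits\<close>)
  next
    case 2
    then show ?thesis
      by (intro nil_clean_matI_identity_block[OF C, where S = "{}" and r = "\<lambda>i. i" and e = "\<lambda>i j. 0"])
        auto
  next
    case 3
    have neg: "x + x = 0" for x :: 'a by (rule char_two_if_two_elements[OF two])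
    \<comment> \<open>In characteristic two the inverse of the bidiagonal matrix \<open>P\<close> is the full upper triangular
      matrix \<open>Q\<close> of ones.  Hence the last column of \<open>Q C P\<close> consists of the tail sums of \<open>y\<close>, the
      last column of \<open>C P\<close>.\<close>
    define P :: "'a mat" where "P = mat n n (\<lambda>(i, j). if i = j \<or> Suc i = j then 1 else 0)"
    define Q :: "'a mat" where "Q = mat n n (\<lambda>(i, j). if i \<le> j then 1 else 0)"
    define y where "y i = C $$ (i, n - 2) + C $$ (i, n - 1)" for i
    define H where "H = mat n n (\<lambda>(i, j). if j = n - 1 then \<Sum>l = i..<n. y l
      else if i = Suc j \<or> i = 0 \<and> j = 0 then 1 else 0)"
    have car: "P \<in> carrier_mat n n" "Q \<in> carrier_mat n n" "H \<in> carrier_mat n n"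
      by (simp_all add: P_def Q_def H_def)
    have P_mult: "(P * A) $$ (i, j) = A $$ (i, j) + (if Suc i < n then A $$ (Suc i, j) else 0)"
      if "A \<in> carrier_mat n n" "i < n" "j < n" for A i j
    proof -
      have "(P * A) $$ (i, j) = (\<Sum>l<n. (if l = i then A $$ (l, j) else 0) + (if l = Suc i then A $$ (l, j) else 0))"
        unfolding index_mult_mat_sum[OF car(1) that]
        by (rule sum.cong) (use that in \<open>auto simp: P_def\<close>)
      then show ?thesis using that by (simp add: sum.distrib)
    qed
    have PQ: "P * Q = 1\<^sub>m n"
    proof (rule eq_matI)
      fix i j assume "i < dim_row (1\<^sub>m n :: 'a mat)" "j < dim_col (1\<^sub>m n :: 'a mat)"
      then have "i < n" "j < n" by auto
      then show "(P * Q) $$ (i, j) = 1\<^sub>m n $$ (i, j)"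
        using P_mult[OF car(2)] neg[of 1] by (auto simp: Q_def)
    qed (use car in auto)
    have "P * H = C * P"
    proof (rule eq_matI)
      fix i j assume "i < dim_row (C * P)" "j < dim_col (C * P)"
      then have ij: "i < n" "j < n" using C car by auto
      have CP: "(C * P) $$ (i, j) = C $$ (i, j) + (if j = 0 then 0 else C $$ (i, j - 1))"
      proof -
        have "(C * P) $$ (i, j) = (\<Sum>l<n. (if l = j then C $$ (i, l) else 0)
            + (if l = j - 1 then if j = 0 then 0 else C $$ (i, l) else 0))"
          unfolding index_mult_mat_sum[OF C car(1) ij]
          by (rule sum.cong) (use ij in \<open>auto simp: P_def\<close>)
        then show ?thesis using ij by (simp add: sum.distrib)
      qed
      show "(P * H) $$ (i, j) = (C * P) $$ (i, j)"
      proof (cases "j = n - 1")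
        case True
        have tail: "(\<Sum>l = i..<n. y l) + (if Suc i < n then \<Sum>l = Suc i..<n. y l else 0) = y i"
        proof -
          have "(if Suc i < n then \<Sum>l = Suc i..<n. y l else 0) = (\<Sum>l = Suc i..<n. y l)" by simp
          then show ?thesis
            using neg[of "\<Sum>l = Suc i..<n. y l"]
            by (simp only: sum.atLeast_Suc_lessThan[OF ij(1)] add.assoc add_0_right)
        qed
        have "(P * H) $$ (i, j)
            = (\<Sum>l = i..<n. y l) + (if Suc i < n then \<Sum>l = Suc i..<n. y l else 0)"
          unfolding P_mult[OF car(3) ij] using True ij by (simp add: H_def)
        also note tail
        also have "y i = (C * P) $$ (i, j)"
          unfolding CP using True 3(2) by (simp add: y_def numeral_2_eq_2 add.commute)
        finally show ?thesis .
      next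
        case False
        with ij have "Suc j < n" by simp
        then show ?thesis
          using ij neg[of 1] col[of i j] col[of i "j - 1"]
          by (simp add: P_mult[OF car(3) ij] CP) (auto simp: H_def)
      qed
    qed (use C car in auto)
    moreover have "nil_clean_mat n H"
    proof (rule nil_clean_mat_twisted_companion[OF two car(3) \<open>2 \<le> n\<close>])
      have "{n - 1..<n} = {n - 1}" using n by auto
      then show "H $$ (n - 1, n - 1) = 1"
        using 3 col[of "n - 1" "n - 2"] by (simp add: H_def y_def)
    qed (auto simp: H_def)
    ultimately show ?thesis by (intro nil_clean_mat_similar[OF C car(3,1,2) PQ])
  qed
qed

section \<open>Reduction to companion matrices\<close>

text \<open>If \<open>x\<close> has a nonzero coordinate \<open>i \<ge> p\<close>, it can take the place of \<open>e\<^sub>i\<close> in the standard basis;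
  exchanging positions \<open>i\<close> and \<open>p\<close> then gives a basis starting with \<open>e\<^sub>0, \<dots>, e\<^bsub>p-1\<^esub>, x\<close>.\<close>

lemma extend_unit_vectors_to_basis:
  fixes x :: "nat \<Rightarrow> 'a::field"
  assumes i: "p \<le> i" "i < n" and x: "x i \<noteq> 0"
  obtains P Q where "P \<in> carrier_mat n n" "Q \<in> carrier_mat n n" "P * Q = 1\<^sub>m n"
    "\<And>a. a < n \<Longrightarrow> P $$ (a, p) = x a"
    "\<And>a b. a < n \<Longrightarrow> b < p \<Longrightarrow> P $$ (a, b) = (if a = b then 1 else 0)"
proof
  define s where "s = Transposition.transpose p i"
  have s: "s b < n \<longleftrightarrow> b < n" "s (s b) = b" "a = s b \<longleftrightarrow> s a = b" for a b
    using i by (auto simp: s_def transpose_def)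
  define P where "P = mat n n (\<lambda>(a, b). if b = p then x a else if a = s b then 1 else 0)"
  \<comment> \<open>Column \<open>i\<close> of the inverse solves \<open>x = \<Sum>\<^sub>a x\<^sub>a e\<^sub>a\<close> for \<open>e\<^sub>i\<close>.\<close>
  define Q where "Q = mat n n (\<lambda>(a, b). if b = i then (if a = p then 1 else - x (s a)) / x i
      else if a = s b then 1 else 0)"
  show car: "P \<in> carrier_mat n n" "Q \<in> carrier_mat n n" by (simp_all add: P_def Q_def)
  show "P * Q = 1\<^sub>m n"
  proof (rule eq_matI)
    fix a b assume "a < dim_row (1\<^sub>m n :: 'a mat)" "b < dim_col (1\<^sub>m n :: 'a mat)"
    then have ab: "a < n" "b < n" by auto
    have "(P * Q) $$ (a, b) = (\<Sum>l<n. (if l = p then x a * Q $$ (p, b) else 0)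
        + (if l = s a then if s a = p then 0 else Q $$ (s a, b) else 0))"
      unfolding index_mult_mat_sum[OF car ab]
      by (rule sum.cong) (use ab s in \<open>auto simp: P_def\<close>)
    also have "\<dots> = x a * Q $$ (p, b) + (if s a = p then 0 else Q $$ (s a, b))"
      using i ab s(1) by (simp add: sum.distrib)
    also have "\<dots> = 1\<^sub>m n $$ (a, b)"
      using ab i x by (auto simp: Q_def s s_def transpose_def)
    finally show "(P * Q) $$ (a, b) = 1\<^sub>m n $$ (a, b)" .
  qed (use car in auto)
  show "P $$ (a, p) = x a" if "a < n" for a
    using that i by (simp add: P_def)
  show "P $$ (a, b) = (if a = b then 1 else 0)" if "a < n" "b < p" for a b
    using that i by (auto simp: P_def s_def transpose_def)
qed

text \<open>The assumption on the columns says that the first \<open>j + 1\<close> basis vectors are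
  \<open>e\<^sub>0, M e\<^sub>0, \<dots>, M\<^sup>j e\<^sub>0\<close>.  If \<open>M e\<^sub>j\<close> is not in their span, it can be made the next basis vector,
  which increases \<open>j\<close>.  Otherwise that span is invariant: \<open>M\<close> is block triangular with a companion
  matrix of size \<open>j + 1\<close> as first block and a smaller matrix as second block.\<close>

lemma nil_clean_mat_if_krylov_columns:
  fixes M :: "'a::field mat"
  assumes two: "\<And>x::'a. x = 0 \<or> x = 1"
    and smaller: "\<And>m (D::'a mat). m < n \<Longrightarrow> D \<in> carrier_mat m m \<Longrightarrow> nil_clean_mat m D"
    and "M \<in> carrier_mat n n" "j < n"
    and "\<And>a b. a < n \<Longrightarrow> b < j \<Longrightarrow> M $$ (a, b) = (if a = Suc b then 1 else 0)"
  shows "nil_clean_mat n M"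
  using assms(3-)
proof (induction "n - j" arbitrary: j M rule: less_induct)
  case less
  note M = less.prems(1) and j = less.prems(2) and col = less.prems(3)
  show ?case
  proof (cases "\<exists>i. j < i \<and> i < n \<and> M $$ (i, j) \<noteq> 0")
    case True
    then obtain i where i: "j < i" "i < n" "M $$ (i, j) \<noteq> 0" by blast
    obtain P Q where car: "P \<in> carrier_mat n n" "Q \<in> carrier_mat n n" and PQ: "P * Q = 1\<^sub>m n"
      and Pj: "\<And>a. a < n \<Longrightarrow> P $$ (a, Suc j) = M $$ (a, j)"
      and Pb: "\<And>a b. a < n \<Longrightarrow> b < Suc j \<Longrightarrow> P $$ (a, b) = (if a = b then 1 else 0)"
      using extend_unit_vectors_to_basis[of "Suc j" i n "\<lambda>a. M $$ (a, j)"] i by (metis Suc_leI)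
    have QP: "Q * P = 1\<^sub>m n" using mat_mult_left_right_inverse[OF car PQ] .
    define H where "H = Q * (M * P)"
    have H: "H \<in> carrier_mat n n" using car M by (auto simp: H_def)
    have PH: "P * H = M * P"
      unfolding H_def using car M PQ by (simp flip: assoc_mult_mat[of P n n Q n _ n])
    have "H $$ (a, b) = (if a = Suc b then 1 else 0)" if ab: "a < n" "b < Suc j" for a b
    proof -
      have b: "b < n" "Suc b < n" using ab i by auto
      have "(M * P) $$ (l, b) = P $$ (l, Suc b)" if l: "l < n" for l
      proof -
        have "(M * P) $$ (l, b) = (\<Sum>c<n. if c = b then M $$ (l, c) else 0)"
          unfolding index_mult_mat_sum[OF M car(1) l b(1)]
          by (rule sum.cong) (use Pb ab in auto)
        also have "\<dots> = M $$ (l, b)" using b by simp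
        also have "\<dots> = P $$ (l, Suc b)"
          using l ab Pj[OF l] Pb[OF l, of "Suc b"] col[OF l, of b] by (cases "b = j") auto
        finally show ?thesis .
      qed
      then have "H $$ (a, b) = (Q * P) $$ (a, Suc b)"
        using car M ab b unfolding H_def
        by (subst (1 2) index_mult_mat_sum[of _ n n _ n]) auto
      then show ?thesis using ab b by (simp add: QP)
    qed
    then have "nil_clean_mat n H"
      using less.hyps[of "Suc j" H] H i by simp
    then show ?thesis by (rule nil_clean_mat_similar[OF M H car PQ PH])
  next
    case False
    define k where "k = Suc j"
    obtain C X Z D where split: "split_block M k k = (C, X, Z, D)" by (metis prod_cases4)
    have "dim_row M = k + (n - k)" "dim_col M = k + (n - k)" using M j by (auto simp: k_def)
    note sb = split_block[OF split this]
    have entry: "C $$ (a, b) = M $$ (a, b)" if "a < k" "b < k" for a b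
      using split that by (auto simp: split_block_def Let_def)
    have "Z = 0\<^sub>m (n - k) k"
    proof (rule eq_matI)
      fix a b assume "a < dim_row (0\<^sub>m (n - k) k :: 'a mat)" "b < dim_col (0\<^sub>m (n - k) k :: 'a mat)"
      then have ab: "a < n - k" "b < k" by auto
      then have "Z $$ (a, b) = M $$ (a + k, b)" using split M by (auto simp: split_block_def Let_def)
      also have "\<dots> = 0"
        using False ab col[of "a + k" b] by (cases "b = j") (auto simp: k_def)
      finally show "Z $$ (a, b) = 0\<^sub>m (n - k) k $$ (a, b)" using ab by simp
    qed (use sb in auto)
    moreover have "nil_clean_mat k C"
      by (rule nil_clean_mat_companion[OF two sb(1)]) (use col entry j in \<open>auto simp: k_def\<close>)
    moreover have "nil_clean_mat (n - k) D"
      using smaller[of "n - k" D] sb(4) j by (simp add: k_def)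
    ultimately have "nil_clean_mat (k + (n - k)) M"
      using nil_clean_mat_block_triangular[OF _ _ sb(2)] sb(5) by simp
    then show ?thesis using j by (simp add: k_def)
  qed
qed

lemma nil_clean_mat_two_elements:
  fixes M :: "'a::field mat"
  assumes two: "\<And>x::'a. x = 0 \<or> x = 1" and "M \<in> carrier_mat n n"
  shows "nil_clean_mat n M"
  using assms(2)
proof (induction n arbitrary: M rule: less_induct)
  case (less n)
  show ?case
  proof (cases "n = 0")
    case True
    with less.prems show ?thesis
      by (intro nil_clean_matI_identity_block[where S = "{}" and r = "\<lambda>i. i" and e = "\<lambda>i j. 0"]) auto
  next
    case False
    show ?thesis
      by (rule nil_clean_mat_if_krylov_columns[OF two _ less.prems, where j = 0])
        (use less.IH False in auto)
  qed
qed

section \<open>Nil-cleanness forces a field with two elements\<close>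

lemma idempotent_scalar_if_nil_clean_mat:
  fixes c :: "'a::field"
  assumes n: "0 < n" and nc: "nil_clean_mat n (c \<cdot>\<^sub>m 1\<^sub>m n)"
  shows "c * c = c"
proof -
  obtain E B k where E: "E \<in> carrier_mat n n" "E * E = E" and B: "B \<in> carrier_mat n n"
    and Bk: "B ^\<^sub>m k = 0\<^sub>m n n" and c: "c \<cdot>\<^sub>m 1\<^sub>m n = E + B"
    using nc unfolding nil_clean_mat_def by blast
  \<comment> \<open>The power \<open>X\<close> of \<open>B\<close> just below the least vanishing one is a nonzero matrix whose rows are
    annihilated by \<open>B\<close>, so they are eigenvectors of \<open>E\<close> for the eigenvalue \<open>c\<close>.\<close>
  define m where "m = (LEAST k. B ^\<^sub>m k = 0\<^sub>m n n)"
  have m: "B ^\<^sub>m m = 0\<^sub>m n n" unfolding m_def using Bk by (rule LeastI)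
  have "1\<^sub>m n $$ (0, 0) \<noteq> (0\<^sub>m n n :: 'a mat) $$ (0, 0)" using n by simp
  then have "m \<noteq> 0" using m B by (metis carrier_matD(1) pow_mat.simps(1))
  then obtain l where l: "m = Suc l" by (cases m) auto
  define X where "X = B ^\<^sub>m l"
  have X: "X \<in> carrier_mat n n" using B by (simp add: X_def)
  have "X \<noteq> 0\<^sub>m n n" unfolding X_def using not_less_Least[of l "\<lambda>k. B ^\<^sub>m k = 0\<^sub>m n n"] l m_def by simp
  then obtain i j where ij: "i < n" "j < n" "X $$ (i, j) \<noteq> 0"
    using X by (metis carrier_matD eq_matI index_zero_mat)
  have XB: "X * B = 0\<^sub>m n n" using m by (simp add: l X_def)
  have "c \<cdot>\<^sub>m X = X * (c \<cdot>\<^sub>m 1\<^sub>m n)"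
    using mult_smult_distrib[OF X one_carrier_mat] right_mult_one_mat[OF X] by metis
  also have "\<dots> = X * E"
    unfolding c using mult_add_distrib_mat[OF X E(1) B] XB mult_carrier_mat[OF X E(1)] by simp
  finally have XE: "X * E = c \<cdot>\<^sub>m X" by simp
  have "c \<cdot>\<^sub>m X = (X * E) * E" using assoc_mult_mat[OF X E(1,1)] E(2) XE by simp
  also have "\<dots> = c \<cdot>\<^sub>m (c \<cdot>\<^sub>m X)"
    unfolding XE using mult_smult_assoc_mat[OF X E(1)] XE by simp
  finally have "(c \<cdot>\<^sub>m X) $$ (i, j) = (c \<cdot>\<^sub>m (c \<cdot>\<^sub>m X)) $$ (i, j)" by simp
  then show ?thesis using ij X by simp
qed

lemma class_ring_iso_F2_iff:
  "(class_ring :: 'a::field ring) \<simeq> F2 \<longleftrightarrow> (\<forall>x::'a. x = 0 \<or> x = 1)"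
proof
  assume "(class_ring :: 'a ring) \<simeq> F2"
  then obtain h :: "'a \<Rightarrow> bit" where "bij_betw h UNIV UNIV"
    unfolding is_ring_iso_def ring_iso_def by auto
  then have inj: "h u = h v \<longleftrightarrow> u = v" for u v by (auto simp: bij_betw_def inj_eq)
  show "\<forall>x::'a. x = 0 \<or> x = 1"
    using inj by (metis (full_types) bit_not_one_iff zero_neq_one)
next
  assume *: "\<forall>x::'a. x = 0 \<or> x = 1"
  then have two: "x = 0 \<or> x = 1" for x :: 'a by blast
  define h :: "'a \<Rightarrow> bit" where "h x = (if x = 0 then 0 else 1)" for x
  have "h \<in> ring_iso class_ring F2"
  proof (rule ring_iso_memI)
    show "h (x \<oplus>\<^bsub>class_ring\<^esub> y) = h x \<oplus>\<^bsub>F2\<^esub> h y" for x y :: 'a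
      using two[of x] two[of y] char_two_if_two_elements[OF two, of 1] by (auto simp: h_def)
    have "b \<in> range h" for b
      by (cases b) (auto simp: h_def image_iff intro: exI[of _ "1::'a"])
    moreover have "inj h" using two by (auto simp: inj_def h_def split: if_splits)
    ultimately show "bij_betw h (carrier class_ring) (carrier F2)" by (auto simp: bij_betw_def)
  qed (auto simp: h_def)
  then show "(class_ring :: 'a ring) \<simeq> F2" unfolding is_ring_iso_def by blast
qed

theorem theorem3:
  shows "((class_ring :: 'a::field ring) \<simeq> F2
            \<longleftrightarrow> (\<forall>n::nat. n > 0 \<longrightarrow> nil_clean_ring (matrix_ring TYPE('a) n)))
       \<and> ((\<forall>n::nat. n > 0 \<longrightarrow> nil_clean_ring (matrix_ring TYPE('a) n))
            \<longleftrightarrow> (\<exists>n::nat. n > 0 \<and> nil_clean_ring (matrix_ring TYPE('a) n)))"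
proof -
  have nc: "nil_clean_ring (matrix_ring TYPE('a) n) \<longleftrightarrow> (\<forall>M::'a mat \<in> carrier_mat n n. nil_clean_mat n M)" for n
    by (simp add: nil_clean_ring_def nil_clean_element_iff_nil_clean_mat ring_mat ring_mat_simps)
  have "\<forall>n>0. nil_clean_ring (matrix_ring TYPE('a) n)" if "\<forall>x::'a. x = 0 \<or> x = 1"
    using that nil_clean_mat_two_elements unfolding nc by blast
  moreover have "\<forall>x::'a. x = 0 \<or> x = 1"
    if ex: "\<exists>n>0. nil_clean_ring (matrix_ring TYPE('a) n)"
  proof
    fix x :: 'a
    obtain n where "n > 0" "nil_clean_ring (matrix_ring TYPE('a) n)" using ex by blast
    then have "x * x = x" using idempotent_scalar_if_nil_clean_mat[of n x] by (simp add: nc)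
    then show "x = 0 \<or> x = 1" by simp
  qed
  moreover have "\<exists>n>0. nil_clean_ring (matrix_ring TYPE('a) n)"
    if "\<forall>n>0. nil_clean_ring (matrix_ring TYPE('a) n)"
    using that by (intro exI[of _ 1]) simp
  ultimately show ?thesis unfolding class_ring_iso_F2_iff by blast
qed

end
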